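(* Let $K$ be a number field with ring of integers $\mathcal{O}_K$, and assume that $T_K \neq \emptyset$, where $T_K$ is the set of prime ideals $\mathfrak{P}$ of $\mathcal{O}_K$ lying above $2$ with ramification index $e(\mathfrak{P}\mid 2)=1$ and inertia degree $f(\mathfrak{P}\mid 2)=1$. Let $a,b\in \mathcal{O}_K\setminus\{0\}$, and let $c=2^d b-3^r$, where $r,d$ are positive integers with $d\geq 2$ and $r$ odd. Then the equation $ax^d-y^2-z^2+xyz-c=0$ has no solution $(x_0,y_0,z_0)\in\mathcal{O}_K^3$ with $2\mid x_0$ (i.e. $x_0\in 2\mathcal{O}_K$).
   Context: For $x_0\in\mathcal{O}_K$, "$2\mid x_0$" means $x_0=2w$ for some $w\in\mathcal{O}_K$. *)

theory Defs
  imports "HOL-Algebra.Algebra"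
begin

text \<open>The image of the ring of rational integers under the unique homomorphism into \<open>R\<close>.\<close>

definition int_image :: "('a, 'b) ring_scheme \<Rightarrow> 'a set" where
  "int_image R = range (\<lambda>k::int. [k] \<cdot>\<^bsub>R\<^esub> \<one>\<^bsub>R\<^esub>)"

text \<open>In characteristic 0 the prime subfield \<open>generate_field K {}\<close> is the field of rationals.\<close>

locale number_field = field K for K (structure) +
  assumes char_zero: "inj (\<lambda>k::int. [k] \<cdot> \<one>)"
    and finite_degree: "finite_dimension (generate_field K {}) (carrier K)"

text \<open>List polynomials have their leading coefficient first; \<open>[]\<close> is the zero polynomial.\<close>

definition ring_of_integers :: "('a, 'b) ring_scheme \<Rightarrow> ('a, 'b) ring_scheme" where
  "ring_of_integers K =
     K\<lparr>carrier := {x \<in> carrier K. \<exists>p \<in> carrier ((int_image K)[X]\<^bsub>K\<^esub>).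
        p \<noteq> [] \<and> lead_coeff p = \<one>\<^bsub>K\<^esub> \<and> ring.eval K p x = \<zero>\<^bsub>K\<^esub>}\<rparr>"

text \<open>The contraction of \<open>P\<close> to the rational integers is the ideal generated by \<open>p\<close>.\<close>

definition lies_above :: "('a, 'b) ring_scheme \<Rightarrow> 'a set \<Rightarrow> int \<Rightarrow> bool" where
  "lies_above R P p \<longleftrightarrow> {k::int. [k] \<cdot>\<^bsub>R\<^esub> \<one>\<^bsub>R\<^esub> \<in> P} = {k. p dvd k}"

text \<open>
  The exact power of \<open>P\<close> dividing \<open>pR\<close> is \<open>P\<^sup>e\<close>. Powers and divisibility are
  those of the multiplicative monoid of ideals. Both this and the inertia degree below are
  relations, so that no junk value arises for rings in which they are not defined.
\<close>

definition has_ramification_index ::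
  "('a, 'b) ring_scheme \<Rightarrow> 'a set \<Rightarrow> int \<Rightarrow> nat \<Rightarrow> bool" where
  "has_ramification_index R P p e \<longleftrightarrow>
     (P [^]\<^bsub>ideals_set R\<^esub> e) divides\<^bsub>ideals_set R\<^esub> (PIdl\<^bsub>R\<^esub> ([p] \<cdot>\<^bsub>R\<^esub> \<one>\<^bsub>R\<^esub>)) \<and>
     \<not> (P [^]\<^bsub>ideals_set R\<^esub> Suc e) divides\<^bsub>ideals_set R\<^esub> (PIdl\<^bsub>R\<^esub> ([p] \<cdot>\<^bsub>R\<^esub> \<one>\<^bsub>R\<^esub>))"

text \<open>
  For a prime ideal \<open>P\<close> above \<open>p\<close>, the image of the integers in the residue
  ring \<open>R/P\<close> is the field with \<open>p\<close> elements.
\<close>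

definition has_inertia_degree :: "('a, 'b) ring_scheme \<Rightarrow> 'a set \<Rightarrow> nat \<Rightarrow> bool" where
  "has_inertia_degree R P f \<longleftrightarrow>
     ring.dimension (R Quot P) f (int_image (R Quot P)) (carrier (R Quot P))"

definition T_set :: "('a, 'b) ring_scheme \<Rightarrow> 'a set set" where
  "T_set K = {P. primeideal P (ring_of_integers K) \<and>
     lies_above (ring_of_integers K) P 2 \<and>
     has_ramification_index (ring_of_integers K) P 2 1 \<and>
     has_inertia_degree (ring_of_integers K) P 1}"

end

theory Submission
  imports Defs
begin

text \<open>
  Let \<open>P\<close> be a prime above \<open>2\<close> with \<open>e = f = 1\<close>. As \<open>r\<close> is odd and \<open>d \<ge> 2\<close>, a solution
  with \<open>x = 2w\<close> satisfies \<open>y\<^sup>2 + z\<^sup>2 - 2wyz \<equiv> 3\<close> modulo \<open>P\<^sup>2\<close>. The residue field has two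
  elements, so exactly one of \<open>y\<close>, \<open>z\<close> lies in \<open>P\<close>; the left-hand side is then \<open>1\<close>
  modulo \<open>P\<^sup>2\<close>, which puts \<open>2\<close> into \<open>P\<^sup>2\<close> and contradicts \<open>e = 1\<close>.
\<close>

section \<open>Residue rings of inertia degree one\<close>

lemma (in ring) int_image_char_two:
  assumes "[(2::int)] \<cdot> \<one> = \<zero>"
  shows "int_image R \<subseteq> {\<zero>, \<one>}"
proof -
  have "[k] \<cdot> \<one> \<in> {\<zero>, \<one>}" for k :: int
  proof -
    have even: "[(2 * q)] \<cdot> \<one> = \<zero>" for q :: int
      using add.int_pow_pow[of \<one> q 2] assms by (simp add: mult.commute)
    have "k = 2 * (k div 2) \<or> k = 2 * (k div 2) + 1" by presburger
    moreover have "[(2 * q + 1)] \<cdot> \<one> = \<one>" for q :: int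
      using even[of q] by (simp add: add.int_pow_mult)
    ultimately show ?thesis
      using even by (metis insertCI)
  qed
  then show ?thesis
    unfolding int_image_def by auto
qed

text \<open>The only scalars are \<zero> and \<one>, so a one-dimensional space over them consists
  of \<zero> and a generator. As \<one> lies in the space, it is that generator, unless \<one> =
  \<zero> and the ring is trivial.\<close>

lemma (in ring) dimension_one_char_two:
  assumes "dimension 1 (int_image R) (carrier R)" and "[(2::int)] \<cdot> \<one> = \<zero>"
  shows "carrier R \<subseteq> {\<zero>, \<one>}"
proof -
  obtain v E where v: "v \<in> carrier R" and E: "dimension 0 (int_image R) E"
    and ext: "carrier R = line_extension (int_image R) v E"
    using assms(1) by (cases rule: dimension.cases) auto
  have "E = {\<zero>}"
    using E by (cases rule: dimension.cases) auto
  have mem: "x = \<zero> \<or> x = v" if x: "x \<in> carrier R" for x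
  proof -
    obtain k where k: "k \<in> int_image R" "x = k \<otimes> v \<oplus> \<zero>"
      using x unfolding ext \<open>E = {\<zero>}\<close> line_extension_mem_iff by blast
    then have "k = \<zero> \<or> k = \<one>"
      using int_image_char_two[OF assms(2)] by blast
    then show ?thesis using k v by auto
  qed
  show ?thesis
  proof
    fix x assume x: "x \<in> carrier R"
    have "x = \<zero>" if "\<one> = \<zero>"
      using l_one[OF x] l_null[OF x] unfolding that by (rule trans[OF sym])
    then show "x \<in> {\<zero>, \<one>}"
      using mem[OF x] mem[OF one_closed] by blast
  qed
qed

lemma (in ideal) a_rcos_eq_minus_mem:
  assumes "x \<in> carrier R" "y \<in> carrier R" "I +> x = I +> y"
  shows "x \<ominus> y \<in> I"
proof -
  obtain i where i: "i \<in> I" "x = i \<oplus> y"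
    using assms a_rcos_self[of x] by (auto simp: a_r_coset_def')
  have "x \<ominus> y = i"
    using i assms(2) Icarr[OF i(1)] by (simp add: a_minus_def a_assoc r_neg)
  then show ?thesis using i by simp
qed

text \<open>Turns the inertia degree into a parity rule for elements: \<open>2\<close> vanishes in
  \<open>R Quot P\<close>, so this quotient has no classes besides those of \<zero> and
  \<one>.\<close>

lemma (in cring) residue_dichotomy:
  assumes P: "ideal P R" and f: "has_inertia_degree R P 1" and two: "[(2::int)] \<cdot> \<one> \<in> P"
    and x: "x \<in> carrier R"
  shows "x \<in> P \<or> x \<ominus> \<one> \<in> P"
proof -
  interpret P: ideal P R by (rule P)
  interpret Q: cring "R Quot P" by (rule P.quotient_is_cring[OF cring_axioms])
  have two': "\<one> \<oplus> \<one> \<in> P"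
    using two add.int_pow_mult[of \<one> 1 1] by simp
  have "\<one>\<^bsub>R Quot P\<^esub> \<oplus>\<^bsub>R Quot P\<^esub> \<one>\<^bsub>R Quot P\<^esub> = P +> (\<one> \<oplus> \<one>)"
    by (simp add: FactRing_def P.a_rcos_sum)
  also have "\<dots> = P" using two' by (rule P.a_rcos_const)
  also have "\<dots> = \<zero>\<^bsub>R Quot P\<^esub>"
    by (simp add: FactRing_def)
  finally have "[(2::int)] \<cdot>\<^bsub>R Quot P\<^esub> \<one>\<^bsub>R Quot P\<^esub> = \<zero>\<^bsub>R Quot P\<^esub>"
    using Q.add.int_pow_mult[of "\<one>\<^bsub>R Quot P\<^esub>" 1 1] by simp
  then have "carrier (R Quot P) \<subseteq> {\<zero>\<^bsub>R Quot P\<^esub>, \<one>\<^bsub>R Quot P\<^esub>}"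
    using Q.dimension_one_char_two f by (simp add: has_inertia_degree_def)
  moreover have "P +> x \<in> carrier (R Quot P)"
    using x by (auto simp: FactRing_def A_RCOSETS_def')
  ultimately have "P +> x = P \<or> P +> x = P +> \<one>"
    by (auto simp: FactRing_def)
  then show ?thesis
    using P.a_rcos_self x P.a_rcos_eq_minus_mem by blast
qed

section \<open>Products of ideals and the ramification index\<close>

text \<open>Commutativity moves \<open>t\<close> through each generator
  \<open>i \<otimes> j\<close>, and distributivity carries it over sums. This permits computing with
  multiples \<open>t S\<close> in place of fractional ideals.\<close>

lemma (in cring) ideal_prod_scale:
  assumes I: "ideal I R" and S: "ideal S R" and t: "t \<in> carrier R"
  shows "I \<cdot> ((\<otimes>) t ` S) = (\<otimes>) t ` (I \<cdot> S)"
proof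
  note c = ideal.Icarr[OF I] ideal.Icarr[OF S] subsetD[OF ideal_prod_in_carrier[OF I S]]
  show "I \<cdot> ((\<otimes>) t ` S) \<subseteq> (\<otimes>) t ` (I \<cdot> S)"
  proof
    fix u assume "u \<in> I \<cdot> ((\<otimes>) t ` S)"
    then show "u \<in> (\<otimes>) t ` (I \<cdot> S)"
    proof (induct u rule: ideal_prod.induct)
      case (prod i j)
      then obtain s where "s \<in> S" "j = t \<otimes> s" by blast
      then have "i \<otimes> j = t \<otimes> (i \<otimes> s)" using prod c t by (simp add: m_lcomm)
      then show ?case using prod \<open>s \<in> S\<close> by (auto intro: ideal_prod.prod)
    next
      case (sum u v)
      then obtain u' v' where "u' \<in> I \<cdot> S" "u = t \<otimes> u'" "v' \<in> I \<cdot> S" "v = t \<otimes> v'" by blast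
      then have "u \<oplus> v = t \<otimes> (u' \<oplus> v')" using c t by (simp add: r_distr)
      then show ?case using \<open>u' \<in> I \<cdot> S\<close> \<open>v' \<in> I \<cdot> S\<close> by (auto intro: ideal_prod.sum)
    qed
  qed
  show "(\<otimes>) t ` (I \<cdot> S) \<subseteq> I \<cdot> ((\<otimes>) t ` S)"
  proof
    fix u assume "u \<in> (\<otimes>) t ` (I \<cdot> S)"
    then obtain v where "v \<in> I \<cdot> S" "u = t \<otimes> v" by blast
    then show "u \<in> I \<cdot> ((\<otimes>) t ` S)"
    proof (induct v arbitrary: u rule: ideal_prod.induct)
      case (prod i j)
      then have "u = i \<otimes> (t \<otimes> j)" using c t by (simp add: m_lcomm)
      then show ?case using prod by (auto intro: ideal_prod.prod)
    next
      case (sum v w)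
      then have "u = t \<otimes> v \<oplus> t \<otimes> w" using c t by (simp add: r_distr)
      then show ?case using sum by (auto intro: ideal_prod.sum)
    qed
  qed
qed

text \<open>
  In a Dedekind domain this holds because containment of ideals is divisibility. Here the
  factorisation \<open>P \<cdot> J = PIdl t\<close> already makes \<open>P\<close> invertible with inverse \<open>t\<inverse> J\<close>, so that
  \<open>P \<cdot> P\<close> has the cofactor \<open>t\<inverse> J \<cdot> J\<close>.
\<close>

lemma (in domain) ideal_square_divides:
  assumes P: "ideal P R" and J: "ideal J R" and t: "t \<in> carrier R" "t \<noteq> \<zero>"
    and PJ: "PIdl t = P \<cdot> J" and mem: "t \<in> P \<cdot> P"
  shows "\<exists>L. ideal L R \<and> PIdl t = (P \<cdot> P) \<cdot> L"
proof -
  \<comment> \<open>This is the fractional ideal \<open>J \<cdot> J\<close> divided by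
    \<open>t\<close>, expressed inside \<open>R\<close>. Nothing is lost as soon as
    \<open>J \<cdot> J\<close> consists of multiples of \<open>t\<close>, which is the content of
    \<open>JL\<close> below.\<close>
  define L where "L = {s \<in> carrier R. t \<otimes> s \<in> J \<cdot> J}"
  have JJ: "ideal (J \<cdot> J) R" and PP: "ideal (P \<cdot> P) R"
    using P J by (simp_all add: ideal_prod_is_ideal)
  interpret JJ: ideal "J \<cdot> J" R by (rule JJ)
  have PJ': "P \<cdot> J = (\<otimes>) t ` carrier R"
    unfolding PJ[symmetric] cgenideal_def using t by (auto simp: m_comm)
  have L: "ideal L R"
  proof (rule idealI[OF ring_axioms])
    show "subgroup L (add_monoid R)"
    proof (rule add.subgroupI)
      show "L \<noteq> {}" using t by (auto simp: L_def intro!: exI[of _ \<zero>])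
      show "\<ominus> u \<in> L" if "u \<in> L" for u
        using that t JJ.a_inv_closed by (auto simp: L_def r_minus)
    qed (use t in \<open>auto simp: L_def r_distr\<close>)
    show "x \<otimes> u \<in> L" "u \<otimes> x \<in> L" if "u \<in> L" "x \<in> carrier R" for u x
      using that t JJ.I_l_closed[of "t \<otimes> u" x]
      by (auto simp: L_def m_lcomm m_comm)
  qed
  have inj: "A = B" if "(\<otimes>) t ` A = (\<otimes>) t ` B" "A \<subseteq> carrier R" "B \<subseteq> carrier R" for A B
  proof -
    have "inj_on ((\<otimes>) t) (carrier R)" using t by (auto simp: inj_on_def m_lcancel)
    then show ?thesis using that inj_on_image_eq_iff by metis
  qed
  \<comment> \<open>Multiply \<open>mem\<close> by \<open>J\<close>: the set \<open>t J\<close> lies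
    in \<open>(P P) J = P (t R) = t P\<close>, and \<open>t\<close> cancels.\<close>
  have "J \<subseteq> P"
  proof
    fix j assume j: "j \<in> J"
    have "t \<otimes> j \<in> (P \<cdot> P) \<cdot> J" using mem j by (rule ideal_prod.prod)
    also have "\<dots> = P \<cdot> ((\<otimes>) t ` carrier R)"
      by (simp add: ideal_prod_assoc P J PJ')
    also have "\<dots> = (\<otimes>) t ` P"
      by (simp add: ideal_prod_scale P oneideal t ideal_prod_one)
    finally obtain p where p: "p \<in> P" "t \<otimes> j = t \<otimes> p" by blast
    then have "j = p"
      using t ideal.Icarr[OF P] ideal.Icarr[OF J j] by (simp add: m_lcancel)
    then show "j \<in> P" using p by simp
  qed
  \<comment> \<open>Since \<open>P \<cdot> J\<close> is \<open>t R\<close>, this makes every element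
    of \<open>J \<cdot> J\<close> divisible by \<open>t\<close>.\<close>
  have "J \<cdot> J \<subseteq> P \<cdot> J"
  proof
    fix u assume "u \<in> J \<cdot> J"
    then show "u \<in> P \<cdot> J"
      using \<open>J \<subseteq> P\<close> by (induct rule: ideal_prod.induct) (auto intro: ideal_prod.intros)
  qed
  then have JL: "J \<cdot> J = (\<otimes>) t ` L"
    unfolding PJ' L_def by auto
  \<comment> \<open>The chain is \<open>t J = (P J) J = P (J J) = P (t L) = t (P L)\<close>.
    Cancelling \<open>t\<close> gives \<open>J = P L\<close>, and inserting this into
    \<open>P J\<close> produces the factor \<open>P P\<close>.\<close>
  have "(\<otimes>) t ` J = (P \<cdot> J) \<cdot> J"
    using ideal_prod_scale[OF J oneideal t(1)] PJ' ideal_prod_commute[OF J ideal_prod_is_ideal[OF P J]]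
    by (simp add: ideal_prod_one J)
  also have "\<dots> = P \<cdot> ((\<otimes>) t ` L)"
    by (simp add: ideal_prod_assoc P J JL)
  also have "\<dots> = (\<otimes>) t ` (P \<cdot> L)"
    by (simp add: ideal_prod_scale P L t)
  finally have "J = P \<cdot> L"
    using inj ideal_prod_in_carrier[OF P L] ideal.Icarr[OF J] by blast
  then have "PIdl t = (P \<cdot> P) \<cdot> L"
    using PJ by (simp add: ideal_prod_assoc P L)
  then show ?thesis using L by blast
qed

text \<open>The ramification index speaks of divisibility of ideals;
  \<open>ideal_square_divides\<close> turns membership in \<open>P \<cdot> P\<close> into
  divisibility by it. That \<open>p\<close> is nonzero in \<open>R\<close> permits the cancellation
  there.\<close>

lemma (in domain) unramified_not_mem_square:
  assumes P: "ideal P R" and e: "has_ramification_index R P p 1" and p: "[p] \<cdot> \<one> \<noteq> \<zero>"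
  shows "[p] \<cdot> \<one> \<notin> P \<cdot> P"
proof
  assume mem: "[p] \<cdot> \<one> \<in> P \<cdot> P"
  \<comment> \<open>Powers in the monoid of ideals start from the unit ideal, so the first power of
    \<open>P\<close> unfolds to \<open>carrier R \<cdot> P\<close>.\<close>
  have one: "carrier R \<cdot> P = P"
    using ideal_prod_commute[OF oneideal P] ideal_prod_one[OF P] by simp
  have pow: "P [^]\<^bsub>ideals_set R\<^esub> (1::nat) = P" "P [^]\<^bsub>ideals_set R\<^esub> Suc 1 = P \<cdot> P"
    using one by (simp_all add: nat_pow_def ideals_set_def)
  obtain J where "ideal J R" "PIdl ([p] \<cdot> \<one>) = P \<cdot> J"
    using e unfolding has_ramification_index_def pow by (auto simp: factor_def ideals_set_def)
  then obtain L where "ideal L R" "PIdl ([p] \<cdot> \<one>) = (P \<cdot> P) \<cdot> L"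
    using ideal_square_divides[OF P _ _ p _ mem] by (metis add.int_pow_closed one_closed)
  then show False
    using e unfolding has_ramification_index_def pow by (auto simp: factor_def ideals_set_def)
qed

section \<open>Congruences modulo the square of an ideal containing 2\<close>

text \<open>The square of 3 is 1 + 4 + 4, hence 1 modulo \<open>P \<cdot> P\<close>; raising the
  exponent by two therefore preserves the residue, which is 3 for exponent 1.\<close>

lemma (in cring) three_pow_odd_mod_ideal_square:
  assumes P: "ideal P R" and two: "\<one> \<oplus> \<one> \<in> P" and "odd r"
  shows "(\<one> \<oplus> \<one> \<oplus> \<one>) [^] (r::nat) \<ominus> (\<one> \<oplus> \<one> \<oplus> \<one>) \<in> P \<cdot> P"
proof -
  let ?th = "\<one> \<oplus> \<one> \<oplus> \<one>"
  interpret PP: ideal "P \<cdot> P" R by (rule ideal_prod_is_ideal[OF P P])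
  have four: "(\<one> \<oplus> \<one>) \<otimes> (\<one> \<oplus> \<one>) \<in> P \<cdot> P"
    using two by (rule ideal_prod.prod[OF _ two])
  obtain k where r: "r = 2 * k + 1"
    using \<open>odd r\<close> by (rule oddE)
  have "?th [^] (2 * k + 1) \<ominus> ?th \<in> P \<cdot> P"
  proof (induct k)
    case 0
    then show ?case by (simp add: a_minus_def r_neg)
  next
    case (Suc k)
    define q where "q = ?th [^] (2 * k + 1)"
    have q: "q \<in> carrier R" by (simp add: q_def)
    have "?th [^] (2 * Suc k + 1) = q \<otimes> ?th \<otimes> ?th"
      by (simp add: q_def)
    moreover have "q \<otimes> ?th \<otimes> ?th \<ominus> ?th \<in> P \<cdot> P"
    proof -
      define t where "t = \<one> \<oplus> \<one>"
      define D where "D = q \<ominus> ?th"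
      have t: "t \<in> carrier R" by (simp add: t_def)
      have D: "D \<in> P \<cdot> P" using Suc by (simp add: D_def q_def)
      have Dc: "D \<in> carrier R" using D by (rule PP.Icarr)
      have tt: "t \<otimes> t \<in> P \<cdot> P" using four by (simp add: t_def)
      have th: "?th = t \<oplus> \<one>" by (simp add: t_def)
      have q_eq: "q = D \<oplus> (t \<oplus> \<one>)"
        unfolding D_def th using q t by (simp add: a_minus_def a_assoc l_neg)
      \<comment> \<open>For \<open>t\<close> = 2 the double and the square coincide. This replaces
        the middle term of \<open>(t \<oplus> \<one>)\<close> squared by another
        \<open>t \<otimes> t\<close>, an element of \<open>P \<cdot> P\<close>.\<close>
      have dbl: "t \<oplus> t = t \<otimes> t"
        by (simp add: t_def l_distr)
      have sq: "(t \<oplus> \<one>) \<otimes> (t \<oplus> \<one>) = (t \<otimes> t \<oplus> t \<otimes> t) \<oplus> \<one>"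
      proof -
        have "(t \<oplus> \<one>) \<otimes> (t \<oplus> \<one>) = (t \<otimes> t \<oplus> (t \<oplus> t)) \<oplus> \<one>"
          using t by (simp add: l_distr r_distr a_ac)
        then show ?thesis by (simp only: dbl)
      qed
      \<comment> \<open>Used with \<open>s\<close> = 3 and \<open>m\<close> = 8, where
        \<open>D\<close> is the error from the induction hypothesis: both summands on the right then
        lie in \<open>P \<cdot> P\<close>.\<close>
      have cube: "(D \<oplus> s) \<otimes> s \<otimes> s \<ominus> s = (s \<otimes> s) \<otimes> D \<oplus> s \<otimes> m"
        if "s \<otimes> s = m \<oplus> \<one>" "s \<in> carrier R" "m \<in> carrier R" for s m
      proof -
        have "(D \<oplus> s) \<otimes> s \<otimes> s \<ominus> s = (s \<otimes> s) \<otimes> D \<oplus> (s \<otimes> (s \<otimes> s) \<ominus> s)"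
          using that(2) Dc by algebra
        also have "s \<otimes> (s \<otimes> s) \<ominus> s = s \<otimes> m"
          using that by (simp add: r_distr a_minus_def a_assoc r_neg)
        finally show ?thesis .
      qed
      have "(t \<oplus> \<one>) \<otimes> (t \<oplus> \<one>) \<otimes> D \<oplus> (t \<oplus> \<one>) \<otimes> (t \<otimes> t \<oplus> t \<otimes> t) \<in> P \<cdot> P"
        using tt D t by (simp add: PP.I_l_closed)
      then show ?thesis
        unfolding q_eq th using cube[OF sq] t by simp
    qed
    ultimately show ?case by simp
  qed
  then show ?thesis by (simp add: r)
qed

text \<open>
  With \<open>y = 1 + p\<close> and \<open>p, z \<in> P\<close>, every term of the relation lies in \<open>P \<cdot> P\<close>
  except \<open>3 - 1 = 2\<close>.
\<close>

lemma (in cring) two_mem_ideal_square_aux: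
  assumes P: "ideal P R" and two: "\<one> \<oplus> \<one> \<in> P"
    and u: "u \<in> P \<cdot> P" and y: "y \<in> carrier R" "y \<ominus> \<one> \<in> P" and z: "z \<in> P" and w: "w \<in> carrier R"
    and eq: "y \<otimes> y \<oplus> z \<otimes> z \<ominus> (\<one> \<oplus> \<one>) \<otimes> w \<otimes> y \<otimes> z = \<one> \<oplus> \<one> \<oplus> \<one> \<oplus> u"
  shows "\<one> \<oplus> \<one> \<in> P \<cdot> P"
proof -
  interpret P: ideal P R by (rule P)
  interpret PP: ideal "P \<cdot> P" R by (rule ideal_prod_is_ideal[OF P P])
  define p where "p = y \<ominus> \<one>"
  have p: "p \<in> P" using y by (simp add: p_def)
  define t where "t = \<one> \<oplus> \<one>"
  have t: "t \<in> P" "t \<in> carrier R" using two by (simp_all add: t_def)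
  have c: "p \<in> carrier R" "z \<in> carrier R" "u \<in> carrier R"
    using p z u by (simp_all add: P.Icarr PP.Icarr)
  have cancel: "k \<oplus> \<one> \<oplus> l \<ominus> m \<ominus> u \<ominus> \<one> = k \<oplus> l \<ominus> m \<ominus> u"
    if "k \<in> carrier R" "l \<in> carrier R" "m \<in> carrier R" for k l m
    using that c one_closed by algebra
  have "t = \<one> \<oplus> t \<oplus> u \<ominus> u \<ominus> \<one>"
    using c t one_closed by algebra
  also have "\<one> \<oplus> t \<oplus> u = y \<otimes> y \<oplus> z \<otimes> z \<ominus> t \<otimes> w \<otimes> y \<otimes> z"
    using eq by (simp add: t_def a_assoc)
  \<comment> \<open>The cross term of the square of \<open>p \<oplus> \<one>\<close> is
    \<open>t \<otimes> p\<close>, a product of two elements of \<open>P\<close>. The summand \<one>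
    left over cancels against the \<one> subtracted at the start.\<close>
  also have "y \<otimes> y = (p \<otimes> p \<oplus> t \<otimes> p) \<oplus> \<one>"
  proof -
    have "y = p \<oplus> \<one>"
      unfolding p_def using y by (simp add: a_minus_def a_assoc l_neg)
    then show ?thesis
      using c by (simp add: t_def l_distr r_distr a_ac)
  qed
  also have "t \<otimes> w \<otimes> y \<otimes> z = (w \<otimes> y) \<otimes> (t \<otimes> z)"
    using c t w y by (simp add: m_ac)
  also have "(p \<otimes> p \<oplus> t \<otimes> p) \<oplus> \<one> \<oplus> z \<otimes> z \<ominus> (w \<otimes> y) \<otimes> (t \<otimes> z) \<ominus> u \<ominus> \<one>
      = (p \<otimes> p \<oplus> t \<otimes> p) \<oplus> z \<otimes> z \<ominus> (w \<otimes> y) \<otimes> (t \<otimes> z) \<ominus> u"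
    by (rule cancel) (use c t w y in simp_all)
  also have "\<dots> \<in> P \<cdot> P"
    unfolding a_minus_def using p z t u c w y
    by (intro PP.a_closed PP.a_inv_closed PP.I_l_closed ideal_prod.prod) auto
  finally show ?thesis by (simp add: t_def)
qed

text \<open>Modulo \<open>P\<close> the relation says that the squares of \<open>y\<close> and
  \<open>z\<close> add up to 1, so exactly one of the two lies in \<open>P\<close>. As the relation
  is symmetric in them, \<open>two_mem_ideal_square_aux\<close> covers both cases.\<close>

lemma (in cring) two_mem_ideal_square:
  assumes P: "ideal P R" and two: "\<one> \<oplus> \<one> \<in> P" and one: "\<one> \<notin> P"
    and res: "\<And>x. x \<in> carrier R \<Longrightarrow> x \<in> P \<or> x \<ominus> \<one> \<in> P"
    and u: "u \<in> P \<cdot> P" and y: "y \<in> carrier R" and z: "z \<in> carrier R" and w: "w \<in> carrier R"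
    and eq: "y \<otimes> y \<oplus> z \<otimes> z \<ominus> (\<one> \<oplus> \<one>) \<otimes> w \<otimes> y \<otimes> z = \<one> \<oplus> \<one> \<oplus> \<one> \<oplus> u"
  shows "\<one> \<oplus> \<one> \<in> P \<cdot> P"
proof -
  interpret P: ideal P R by (rule P)
  define t where "t = \<one> \<oplus> \<one>"
  have t: "t \<in> P" "t \<in> carrier R" using two by (simp_all add: t_def)
  have uP: "u \<in> P" using u ideal_prod_inter[OF P P] by blast
  have c: "u \<in> carrier R" using uP by (rule P.Icarr)
  have eq': "y \<otimes> y \<oplus> z \<otimes> z \<ominus> t \<otimes> w \<otimes> y \<otimes> z = \<one> \<oplus> t \<oplus> u"
    using eq by (simp add: t_def a_assoc)
  \<comment> \<open>Solving the relation for \<one> lets both excluded parity cases end in the same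
    contradiction, \<one> lying in \<open>P\<close>.\<close>
  have "\<one> = \<one> \<oplus> t \<oplus> u \<ominus> u \<ominus> t"
    using c t one_closed by algebra
  also have "\<one> \<oplus> t \<oplus> u = y \<otimes> y \<oplus> z \<otimes> z \<ominus> t \<otimes> w \<otimes> y \<otimes> z"
    using eq' by simp
  finally have one_eq: "\<one> = y \<otimes> y \<oplus> z \<otimes> z \<ominus> t \<otimes> w \<otimes> y \<otimes> z \<ominus> u \<ominus> t" .
  have not_even: "\<not> (y \<in> P \<and> z \<in> P)"
  proof
    assume "y \<in> P \<and> z \<in> P"
    then have "y \<otimes> y \<oplus> z \<otimes> z \<ominus> t \<otimes> w \<otimes> y \<otimes> z \<ominus> u \<ominus> t \<in> P"
      unfolding a_minus_def using t uP w y z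
      by (intro P.a_closed P.a_inv_closed P.I_l_closed) auto
    then show False using one one_eq by simp
  qed
  have not_odd: "\<not> (y \<ominus> \<one> \<in> P \<and> z \<ominus> \<one> \<in> P)"
  proof
    assume a: "y \<ominus> \<one> \<in> P \<and> z \<ominus> \<one> \<in> P"
    define p p' where "p = y \<ominus> \<one>" and "p' = z \<ominus> \<one>"
    have p: "p \<in> P" "p' \<in> P" using a by (simp_all add: p_def p'_def)
    \<comment> \<open>Subtracting \<open>t\<close> takes one \<one> from each square, and each
      difference factors as \<open>(y \<oplus> \<one>) \<otimes> (y \<ominus> \<one>)\<close>,
      likewise for \<open>z\<close>.\<close>
    have "y \<otimes> y \<oplus> z \<otimes> z \<ominus> t \<otimes> w \<otimes> y \<otimes> z \<ominus> u \<ominus> t =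
        (y \<oplus> \<one>) \<otimes> p \<oplus> (z \<oplus> \<one>) \<otimes> p' \<ominus> (w \<otimes> y \<otimes> z) \<otimes> t \<ominus> u"
      unfolding t_def p_def p'_def using c w y z one_closed by algebra
    also have "\<dots> \<in> P"
      unfolding a_minus_def using p t uP w y z
      by (intro P.a_closed P.a_inv_closed P.I_l_closed) auto
    finally show False using one one_eq by simp
  qed
  consider "y \<ominus> \<one> \<in> P" "z \<in> P" | "z \<ominus> \<one> \<in> P" "y \<in> P"
    using res[OF y] res[OF z] not_even not_odd by blast
  then show ?thesis
  proof cases
    case 1
    then show ?thesis
      using two_mem_ideal_square_aux[OF P two u y _ _ w eq] by simp
  next
    case 2
    have "z \<otimes> z \<oplus> y \<otimes> y \<ominus> (\<one> \<oplus> \<one>) \<otimes> w \<otimes> z \<otimes> y = y \<otimes> y \<oplus> z \<otimes> z \<ominus> (\<one> \<oplus> \<one>) \<otimes> w \<otimes> y \<otimes> z"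
      using w y z one_closed by algebra
    then show ?thesis
      using two_mem_ideal_square_aux[OF P two u z _ _ w] 2 eq by simp
  qed
qed

section \<open>The equation over a domain with a suitable ideal above 2\<close>

lemma (in domain) no_solution_of_degree_one_prime:
  assumes P: "ideal P R" and above: "lies_above R P 2"
    and e: "has_ramification_index R P 2 1" and f: "has_inertia_degree R P 1"
    and two: "\<one> \<oplus> \<one> \<noteq> \<zero>"
    and a: "a \<in> carrier R" and b: "b \<in> carrier R" and "odd r" and "d \<ge> 2"
    and w: "w \<in> carrier R" and y: "y \<in> carrier R" and z: "z \<in> carrier R"
  shows "a \<otimes> ((\<one> \<oplus> \<one>) \<otimes> w) [^] (d::nat) \<ominus> y [^] (2::nat) \<ominus> z [^] (2::nat)
      \<oplus> ((\<one> \<oplus> \<one>) \<otimes> w) \<otimes> y \<otimes> z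
      \<ominus> ((\<one> \<oplus> \<one>) [^] d \<otimes> b \<ominus> (\<one> \<oplus> \<one> \<oplus> \<one>) [^] (r::nat)) \<noteq> \<zero>"
    (is "?F \<noteq> \<zero>")
proof
  assume eq: "?F = \<zero>"
  interpret PP: ideal "P \<cdot> P" R by (rule ideal_prod_is_ideal[OF P P])
  have two_eq: "[(2::int)] \<cdot> \<one> = \<one> \<oplus> \<one>"
    using add.int_pow_mult[of \<one> 1 1] by simp
  have mem: "[k] \<cdot> \<one> \<in> P \<longleftrightarrow> 2 dvd k" for k :: int
    using above unfolding lies_above_def by blast
  have twoP: "\<one> \<oplus> \<one> \<in> P" and oneP: "\<one> \<notin> P"
    using mem[of 2] mem[of 1] two_eq by simp_all
  define t where "t = \<one> \<oplus> \<one>"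
  define q where "q = (\<one> \<oplus> \<one> \<oplus> \<one>) [^] r"
  \<comment> \<open>The subtraction is genuine because \<open>d \<ge> 2\<close>; thus
    \<open>s\<close> is the cofactor of \<open>t \<otimes> t\<close> in
    \<open>t [^] d\<close>.\<close>
  define s where "s = t [^] (d - 2)"
  define v where "v = w [^] d"
  define g where "g = q \<ominus> (\<one> \<oplus> \<one> \<oplus> \<one>)"
  have c: "t \<in> carrier R" "q \<in> carrier R" "s \<in> carrier R" "v \<in> carrier R" "g \<in> carrier R"
    using w by (simp_all add: t_def q_def s_def v_def g_def)
  have nat_pow_two: "x [^] (2::nat) = x \<otimes> x" if "x \<in> carrier R" for x
    using that by (simp add: numeral_2_eq_2)
  have d: "t [^] d = s \<otimes> (t \<otimes> t)"
  proof -
    have "t [^] d = t [^] (d - 2 + 2)"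
      using \<open>d \<ge> 2\<close> by (simp only: le_add_diff_inverse2)
    also have "\<dots> = t [^] (d - 2) \<otimes> t [^] (2::nat)"
      using nat_pow_mult[OF c(1)] by (rule sym)
    finally show ?thesis unfolding s_def nat_pow_two[OF c(1)] .
  qed
  \<comment> \<open>This collects all that vanishes modulo \<open>P \<cdot> P\<close> when the
    equation is solved for the terms in \<open>y\<close> and \<open>z\<close>: the two multiples of
    \<open>t [^] d\<close> and the difference \<open>g\<close> between the power of 3 and 3.\<close>
  define u where "u = (a \<otimes> s \<otimes> v) \<otimes> (t \<otimes> t) \<ominus> (s \<otimes> b) \<otimes> (t \<otimes> t) \<oplus> g"
  have tt: "t \<otimes> t \<in> P \<cdot> P"
    using twoP by (simp add: t_def ideal_prod.prod)
  have "g \<in> P \<cdot> P"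
    unfolding g_def q_def by (rule three_pow_odd_mod_ideal_square[OF P twoP \<open>odd r\<close>])
  then have u: "u \<in> P \<cdot> P"
    unfolding u_def a_minus_def using c a b
    by (intro PP.a_closed PP.a_inv_closed PP.I_l_closed[OF tt]) auto
  have F: "a \<otimes> (s \<otimes> (t \<otimes> t) \<otimes> v) \<ominus> y \<otimes> y \<ominus> z \<otimes> z \<oplus> (t \<otimes> w) \<otimes> y \<otimes> z
      \<ominus> (s \<otimes> (t \<otimes> t) \<otimes> b \<ominus> q) = \<zero>"
    using eq[folded q_def, folded t_def] c w y z d
    by (simp add: v_def nat_pow_distrib nat_pow_two)
  have rearrange: "Y \<oplus> Z \<ominus> W = q \<oplus> A \<ominus> B"
    if "A \<ominus> Y \<ominus> Z \<oplus> W \<ominus> (B \<ominus> q) = \<zero>" "A \<in> carrier R" "B \<in> carrier R"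
      "W \<in> carrier R" "Y \<in> carrier R" "Z \<in> carrier R" for A B W Y Z
  proof -
    have "Y \<oplus> Z \<ominus> W = q \<oplus> A \<ominus> B \<ominus> (A \<ominus> Y \<ominus> Z \<oplus> W \<ominus> (B \<ominus> q))"
      using that(2-) c(2) by algebra
    also have "\<dots> = q \<oplus> A \<ominus> B"
      using that c(2) by (simp add: a_minus_def)
    finally show ?thesis .
  qed
  have "y \<otimes> y \<oplus> z \<otimes> z \<ominus> t \<otimes> w \<otimes> y \<otimes> z
      = q \<oplus> a \<otimes> (s \<otimes> (t \<otimes> t) \<otimes> v) \<ominus> s \<otimes> (t \<otimes> t) \<otimes> b"
    by (rule rearrange[OF F]) (use c a b w y z in simp_all)
  also have "\<dots> = q \<oplus> ((a \<otimes> s \<otimes> v) \<otimes> (t \<otimes> t) \<ominus> (s \<otimes> b) \<otimes> (t \<otimes> t))"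
    using c a b by algebra
  also have "q = \<one> \<oplus> \<one> \<oplus> \<one> \<oplus> g"
    unfolding g_def using c one_closed by algebra
  also have "\<one> \<oplus> \<one> \<oplus> \<one> \<oplus> g \<oplus> ((a \<otimes> s \<otimes> v) \<otimes> (t \<otimes> t) \<ominus> (s \<otimes> b) \<otimes> (t \<otimes> t))
      = \<one> \<oplus> \<one> \<oplus> \<one> \<oplus> u"
    unfolding u_def using c a b by (simp add: a_ac)
  finally have "y \<otimes> y \<oplus> z \<otimes> z \<ominus> (\<one> \<oplus> \<one>) \<otimes> w \<otimes> y \<otimes> z = \<one> \<oplus> \<one> \<oplus> \<one> \<oplus> u"
    unfolding t_def .
  moreover have "x \<in> P \<or> x \<ominus> \<one> \<in> P" if "x \<in> carrier R" for x
    using residue_dichotomy[OF P f _ that] mem[of 2] by simp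
  ultimately have "\<one> \<oplus> \<one> \<in> P \<cdot> P"
    using two_mem_ideal_square[OF P twoP oneP _ u y z w] by blast
  then show False
    using unramified_not_mem_square[OF P e] two two_eq by simp
qed

section \<open>Transfer to the ring of integers\<close>

theorem theorem2p1:
  fixes K :: "('a, 'b) ring_scheme" (structure)
    and a b c :: 'a and r d :: nat
  assumes "number_field K"
    and "T_set K \<noteq> {}"
    and "a \<in> carrier (ring_of_integers K) - {\<zero>}"
    and "b \<in> carrier (ring_of_integers K) - {\<zero>}"
    and "r > 0" and "odd r" and "d \<ge> 2"
    and "c = (([(2::int)] \<cdot> \<one>) [^] d) \<otimes> b \<ominus> ([(3::int)] \<cdot> \<one>) [^] r"
  shows "\<not> (\<exists>x \<in> carrier (ring_of_integers K).
            \<exists>y \<in> carrier (ring_of_integers K).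
            \<exists>z \<in> carrier (ring_of_integers K).
              (\<exists>w \<in> carrier (ring_of_integers K). x = ([(2::int)] \<cdot> \<one>) \<otimes> w) \<and>
              a \<otimes> x [^] d \<ominus> y [^] (2::nat) \<ominus> z [^] (2::nat) \<oplus> x \<otimes> y \<otimes> z \<ominus> c = \<zero>)"
proof -
  interpret number_field K by (rule assms(1))
  define R where "R = ring_of_integers K"
  obtain P where P: "primeideal P R" "lies_above R P 2"
    "has_ramification_index R P 2 1" "has_inertia_degree R P 1"
    using assms(2) by (auto simp: T_set_def R_def)
  \<comment> \<open>The locale of ideals includes the ring axioms, so the existence of
    \<open>P\<close> supplies that the integral elements form a ring.\<close>
  then have "ring R"
    by (simp add: primeideal_def ideal_def)
  define S where "S = carrier R"
  have R: "R = K\<lparr>carrier := S\<rparr>"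
    by (simp add: S_def R_def ring_of_integers_def)
  have "S \<subseteq> carrier K"
    by (auto simp: S_def R_def ring_of_integers_def)
  then have sub: "subring S K"
    using subring_iff \<open>ring R\<close> R by simp
  interpret R: domain R
    unfolding R by (rule subring_is_domain[OF sub])
  interpret P: primeideal P R by (rule P)
  have ops: "x \<oplus>\<^bsub>R\<^esub> y = x \<oplus> y" "x \<otimes>\<^bsub>R\<^esub> y = x \<otimes> y" "x [^]\<^bsub>R\<^esub> (n::nat) = x [^] n"
    "\<one>\<^bsub>R\<^esub> = \<one>" "\<zero>\<^bsub>R\<^esub> = \<zero>" for x y n
    by (simp_all add: R nat_pow_def)
  \<comment> \<open>Unlike the operations in \<open>ops\<close>, the additive inverse is defined by
    a search within the carrier, so its agreement in \<open>R\<close> and \<open>K\<close> rests on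
    \<open>S\<close> being an additive subgroup.\<close>
  have minus: "x \<ominus>\<^bsub>R\<^esub> y = x \<ominus> y" if "y \<in> S" for x y
  proof -
    have "\<ominus>\<^bsub>R\<^esub> y = \<ominus> y"
      using that add.m_inv_consistent[of S] subring.axioms(1)[OF sub]
      by (simp add: R a_inv_def)
    then show ?thesis by (simp add: a_minus_def ops)
  qed
  have num: "[(2::int)] \<cdot> \<one> = \<one> \<oplus> \<one>" "[(3::int)] \<cdot> \<one> = \<one> \<oplus> \<one> \<oplus> \<one>"
    using add.int_pow_mult[of \<one> 1 1] add.int_pow_mult[of \<one> 2 1] by simp_all
  have "\<one> \<oplus> \<one> \<noteq> \<zero>"
    using num(1) injD[OF char_zero, of 2 0] by (auto simp: add_pow_def int_pow_def)
  note no_sol = R.no_solution_of_degree_one_prime[OF P.is_ideal P(2-4), unfolded ops, OF this]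
  show ?thesis
  proof clarify
    fix y z w
    assume "y \<in> carrier (ring_of_integers K)" "z \<in> carrier (ring_of_integers K)"
      "w \<in> carrier (ring_of_integers K)"
    then have yzw: "y \<in> carrier R" "z \<in> carrier R" "w \<in> carrier R"
      by (simp_all add: R_def)
    have ab: "a \<in> carrier R" "b \<in> carrier R"
      using assms(3,4) by (simp_all add: R_def)
    \<comment> \<open>As \<open>minus\<close> holds only for subtrahends in \<open>S\<close>, every
      subtrahend of the equation has to be shown to lie there.\<close>
    have closed: "x \<otimes> y \<in> S" "x \<oplus> y \<in> S" "x \<ominus> y \<in> S" if "x \<in> S" "y \<in> S" for x y
      using that R.m_closed R.a_closed R.minus_closed
      by (simp_all add: S_def ops minus[unfolded S_def, symmetric])
    have pow_closed: "x [^] (n::nat) \<in> S" if "x \<in> S" for x n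
      using that R.nat_pow_closed by (simp add: S_def ops)
    have one_mem: "\<one> \<in> S"
      using R.one_closed by (simp add: S_def ops)
    assume "a \<otimes> ([(2::int)] \<cdot> \<one> \<otimes> w) [^] d \<ominus> y [^] (2::nat) \<ominus> z [^] (2::nat)
      \<oplus> [(2::int)] \<cdot> \<one> \<otimes> w \<otimes> y \<otimes> z \<ominus> c = \<zero>"
    then show False
      using no_sol[OF ab \<open>odd r\<close> \<open>d \<ge> 2\<close> yzw(3,1,2)] yzw ab
      by (simp add: assms(8) num minus closed pow_closed one_mem S_def[symmetric])
  qed
qed

end
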